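(* Let $\mathcal{M}=(Q,A,\delta,\lambda)$ be an invertible reset Mealy automaton whose modified state functions $\widetilde{\lambda_q}$, $q\in Q$, are pairwise distinct. Then the automata semigroup $\mathcal{S}(\mathcal{M})$ is a free semigroup on $\{\mathcal{M}_q : q\in Q\}$.
   Context: A (finite state) Mealy automaton is a tuple $\mathcal{M}=(Q,A,\delta,\lambda)$ with $Q$ a finite set of states, $A$ a finite alphabet, $\delta:Q\times A\to Q$ the transition function and $\lambda:Q\times A\to A$ the output function. Write $q\cdot a=\delta(q,a)$ and $q\circ a=\lambda(q,a)$, extended to words $u\in A^*$ by $q\cdot(ua)=(q\cdot u)\cdot a$ and $q\circ(ua)=(q\circ u)((q\cdot u)\circ a)$ (the empty word acts as the identity on states and has empty output). For $H\subseteq Q$ put $H\cdot u=\{q\cdot u:q\in H\}$. For $q\in Q$ the transformation $\mathcal{M}_q:A^*\to A^*$ is $\mathcal{M}_q(u)=q\circ u$. $\mathcal{M}$ is invertible if for each $q\in Q$ the map $a\mapsto\lambda(q,a)$ is a permutation of $A$. The automata semigroup $\mathcal{S}(\mathcal{M})$ is the semigroup of transformations of $A^*$ generated under composition by $\{\mathcal{M}_q:q\in Q\}$. $\mathrm{Syn}(\mathcal{M})=\{u\in A^*: |Q\cdot u|=1\}$ is the set of synchronizing (reset) words; $\mathcal{M}$ is synchronizing if $\mathrm{Syn}(\mathcal{M})\neq\emptyset$. $\mathcal{M}$ is called reset if (i) $\mathcal{M}$ is synchronizing, and (ii) $\mathcal{M}_q(\mathrm{Syn}(\mathcal{M}))\subseteq\mathrm{Syn}(\mathcal{M})$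 for every $q\in Q$. For a reset Mealy automaton and $q\in Q$, the modified state function $\widetilde{\lambda_q}:\mathrm{Syn}(\mathcal{M})\to Q$ sends $u$ to the unique element of $Q\cdot(q\circ u)$.
   Formalization: The automaton is assumed to have at least two states: with a single state the modified state functions are vacuously distinct, but M_q is a letterwise permutation of finite order, so the automata semigroup is finite and not free. *)

theory Defs
  imports Main "HOL-Library.FuncSet"
begin

record ('q, 'a) mealy =
  states :: "'q set"
  alphabet :: "'a set"
  next_state :: "'q \<Rightarrow> 'a \<Rightarrow> 'q"
  out_letter :: "'q \<Rightarrow> 'a \<Rightarrow> 'a"

locale mealy_automaton =
  fixes M :: "('q, 'a) mealy"
  assumes finite_states: "finite (states M)"
    and finite_alphabet: "finite (alphabet M)"
    and next_state_closed:
      "\<And>q a. q \<in> states M \<Longrightarrow> a \<in> alphabet M \<Longrightarrow> next_state M q a \<in> states M"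
    and output_closed:
      "\<And>q a. q \<in> states M \<Longrightarrow> a \<in> alphabet M \<Longrightarrow> out_letter M q a \<in> alphabet M"

definition state_word :: "('q, 'a) mealy \<Rightarrow> 'q \<Rightarrow> 'a list \<Rightarrow> 'q" where
  "state_word M q u = foldl (next_state M) q u"

primrec output_word :: "('q, 'a) mealy \<Rightarrow> 'q \<Rightarrow> 'a list \<Rightarrow> 'a list" where
  "output_word M q [] = []"
| "output_word M q (a # u) = out_letter M q a # output_word M (next_state M q a) u"

(* The usual recursion, which appends letters on the right. *)

lemma state_word_snoc:
  "state_word M q [] = q"
  "state_word M q (u @ [a]) = next_state M (state_word M q u) a"
  by (simp_all add: state_word_def)

lemma output_word_snoc:
  "output_word M q (u @ [a]) = output_word M q u @ [out_letter M (state_word M q u) a]"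
  by (induction u arbitrary: q) (simp_all add: state_word_def)

definition state_set_word :: "('q, 'a) mealy \<Rightarrow> 'q set \<Rightarrow> 'a list \<Rightarrow> 'q set" where
  "state_set_word M H u = (\<lambda>q. state_word M q u) ` H"

(* Transformations of the set of words over the alphabet are extensional functions
   on that set, so that HOL equality is equality of transformations; accordingly they
   are composed with compose. *)
definition mealy_fun :: "('q, 'a) mealy \<Rightarrow> 'q \<Rightarrow> 'a list \<Rightarrow> 'a list" where
  "mealy_fun M q = (\<lambda>u\<in>lists (alphabet M). output_word M q u)"

definition invertible_mealy :: "('q, 'a) mealy \<Rightarrow> bool" where
  "invertible_mealy M \<longleftrightarrow> (\<forall>q\<in>states M. bij_betw (out_letter M q) (alphabet M) (alphabet M))"

definition Syn :: "('q, 'a) mealy \<Rightarrow> 'a list set" where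
  "Syn M = {u \<in> lists (alphabet M). card (state_set_word M (states M) u) = 1}"

definition synchronizing :: "('q, 'a) mealy \<Rightarrow> bool" where
  "synchronizing M \<longleftrightarrow> Syn M \<noteq> {}"

definition reset_mealy :: "('q, 'a) mealy \<Rightarrow> bool" where
  "reset_mealy M \<longleftrightarrow> synchronizing M \<and> (\<forall>q\<in>states M. mealy_fun M q ` Syn M \<subseteq> Syn M)"

(* Extensional on Syn M, so that two of these functions are equal iff they agree on Syn M.
   For a reset automaton the argument of the_elem is a singleton. *)
definition modified_state_fun :: "('q, 'a) mealy \<Rightarrow> 'q \<Rightarrow> 'a list \<Rightarrow> 'q" where
  "modified_state_fun M q =
    (\<lambda>u\<in>Syn M. the_elem (state_set_word M (states M) (mealy_fun M q u)))"

inductive_set generated_semigroup :: "('s \<Rightarrow> 's \<Rightarrow> 's) \<Rightarrow> 's set \<Rightarrow> 's set"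
  for m :: "'s \<Rightarrow> 's \<Rightarrow> 's" and X :: "'s set" where
  generator: "x \<in> X \<Longrightarrow> x \<in> generated_semigroup m X"
| mult: "x \<in> generated_semigroup m X \<Longrightarrow> y \<in> generated_semigroup m X \<Longrightarrow>
    m x y \<in> generated_semigroup m X"

definition automata_semigroup :: "('q, 'a) mealy \<Rightarrow> ('a list \<Rightarrow> 'a list) set" where
  "automata_semigroup M =
    generated_semigroup (compose (lists (alphabet M))) (mealy_fun M ` states M)"

definition is_semigroup :: "'s set \<Rightarrow> ('s \<Rightarrow> 's \<Rightarrow> 's) \<Rightarrow> bool" where
  "is_semigroup S m \<longleftrightarrow>
    (\<forall>x\<in>S. \<forall>y\<in>S. m x y \<in> S) \<and>
    (\<forall>x\<in>S. \<forall>y\<in>S. \<forall>z\<in>S. m (m x y) z = m x (m y z))"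

(* Product of a nonempty word; the empty word has no value in a semigroup. *)
fun word_prod :: "('s \<Rightarrow> 's \<Rightarrow> 's) \<Rightarrow> 's list \<Rightarrow> 's" where
  "word_prod m [x] = x"
| "word_prod m (x # y # xs) = m x (word_prod m (y # xs))"

(* S is free on X iff the canonical homomorphism from the semigroup of nonempty words
   over X (under concatenation) to S is an isomorphism. *)
definition free_semigroup_on :: "'s set \<Rightarrow> ('s \<Rightarrow> 's \<Rightarrow> 's) \<Rightarrow> 's set \<Rightarrow> bool" where
  "free_semigroup_on S m X \<longleftrightarrow>
    is_semigroup S m \<and> X \<subseteq> S \<and> bij_betw (word_prod m) {w \<in> lists X. w \<noteq> []} S"

(* A one-state invertible automaton is reset and vacuously has pairwise distinct modified
   state functions, but it acts by a letterwise permutation of finite order, so its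
   semigroup is finite. Hence freeness needs at least two states; the smallest case: *)
lemma one_state_not_free:
  fixes M :: "(unit, unit) mealy"
  assumes M_def: "M = \<lparr>states = UNIV, alphabet = UNIV,
    next_state = \<lambda>_ _. (), out_letter = \<lambda>_ _. ()\<rparr>"
  shows "mealy_automaton M" and "invertible_mealy M" and "reset_mealy M"
    and "inj_on (modified_state_fun M) (states M)"
    and "\<not> free_semigroup_on (automata_semigroup M) (compose (lists (alphabet M)))
           (mealy_fun M ` states M)"
proof -
  have syn: "Syn M = UNIV"
    by (auto simp: Syn_def M_def state_set_word_def UNIV_unit)
  show "mealy_automaton M"
    by unfold_locales (simp_all add: M_def)
  show "invertible_mealy M"
    by (simp add: invertible_mealy_def M_def bij_betw_def inj_on_def UNIV_unit)
  show "reset_mealy M"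
    by (simp add: reset_mealy_def synchronizing_def syn)
  show "inj_on (modified_state_fun M) (states M)"
    by (simp add: inj_on_def)
  have out: "output_word M q u = u" for q u
    by (induction u arbitrary: q) (simp_all add: M_def)
  define f where "f = mealy_fun M ()"
  have f: "f = id"
    by (rule ext) (simp add: f_def mealy_fun_def out, simp add: M_def)
  have "word_prod (compose (lists (alphabet M))) [f, f]
      = word_prod (compose (lists (alphabet M))) [f]"
    by (rule ext) (simp add: f compose_def M_def)
  moreover have "f \<in> mealy_fun M ` states M"
    by (simp add: f_def M_def)
  ultimately show "\<not> free_semigroup_on (automata_semigroup M)
      (compose (lists (alphabet M))) (mealy_fun M ` states M)"
    unfolding free_semigroup_on_def bij_betw_def inj_on_def
    by (metis (mono_tags, lifting) lists.intros list.distinct(1) list.inject mem_Collect_eq)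
qed

end

theory Submission
  imports Defs
begin

text \<open>
  Let \<open>\<sigma> u\<close> be the state reached by a reset word \<open>u\<close>.  After reading \<open>u\<close>, the transformation
  of a product \<open>p\<^sub>1 \<dots> p\<^sub>n\<close> (with \<open>p\<^sub>n\<close> acting first) continues as that of a product whose last two
  factors are \<open>\<sigma> (p\<^sub>n \<circ> u)\<close> and \<open>\<sigma> u\<close>, and the last factor can be cancelled by invertibility.
  If two products of equal length agree as transformations and differ in their last factors
  \<open>p\<^sub>n \<noteq> r\<^sub>n\<close>, choose \<open>u\<close> with \<open>\<sigma> (p\<^sub>n \<circ> u) \<noteq> \<sigma> (r\<^sub>n \<circ> u)\<close>: cancelling \<open>\<sigma> u\<close> gives shorter such
  products, so equal products of equal length coincide by induction.  For unequal lengths,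
  repeatedly passing to a reset word and cancelling leaves a nonempty product acting as the
  identity.  As \<open>\<sigma>\<close> takes two values, its continuations after two suitable reset words are
  distinct products of equal length, both acting as the identity, which is impossible.
\<close>

section \<open>Products of states acting on words, and their sections\<close>

primrec act :: "('q, 'a) mealy \<Rightarrow> 'q list \<Rightarrow> 'a list \<Rightarrow> 'a list" where
  "act M [] u = u"
| "act M (q # w) u = output_word M q (act M w u)"

text \<open>The section of a product at \<open>u\<close>: the states its factors have reached once
  \<open>u\<close> has passed through, each factor having read the output of those to its
  right.\<close>

primrec act_section :: "('q, 'a) mealy \<Rightarrow> 'q list \<Rightarrow> 'a list \<Rightarrow> 'q list" where
  "act_section M [] u = []"
| "act_section M (q # w) u = state_word M q (act M w u) # act_section M w u"

text \<open>The \<sigma> of the proof idea; meaningful only on reset words, where the set is a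
  singleton.\<close>

abbreviation sync_state :: "('q, 'a) mealy \<Rightarrow> 'a list \<Rightarrow> 'q" where
  "sync_state M u \<equiv> the_elem (state_set_word M (states M) u)"

definition act_eq :: "('q, 'a) mealy \<Rightarrow> 'q list \<Rightarrow> 'q list \<Rightarrow> bool" where
  "act_eq M w w' \<longleftrightarrow> (\<forall>u\<in>lists (alphabet M). act M w u = act M w' u)"

definition act_fun :: "('q, 'a) mealy \<Rightarrow> 'q list \<Rightarrow> 'a list \<Rightarrow> 'a list" where
  "act_fun M w = restrict (act M w) (lists (alphabet M))"

lemma mealy_fun_eq_act_fun: "mealy_fun M q = act_fun M [q]"
  by (auto simp: mealy_fun_def act_fun_def)

lemma act_fun_eq_iff: "act_fun M w = act_fun M w' \<longleftrightarrow> act_eq M w w'"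
  by (auto simp: act_fun_def act_eq_def fun_eq_iff)

lemma length_output_word [simp]: "length (output_word M q u) = length u"
  by (induction u arbitrary: q) auto

lemma length_act [simp]: "length (act M w u) = length u"
  by (induction w) auto

lemma length_act_section [simp]: "length (act_section M w u) = length w"
  by (induction w) auto

lemma output_word_append:
  "output_word M q (u @ v) = output_word M q u @ output_word M (state_word M q u) v"
  by (induction u arbitrary: q) (simp_all add: state_word_def)

lemma act_append: "act M (w @ w') u = act M w (act M w' u)"
  by (induction w) auto

lemma act_word_append: "act M w (u @ v) = act M w u @ act M (act_section M w u) v"
  by (induction w) (auto simp: output_word_append)

lemma act_section_append:
  "act_section M (w @ w') u = act_section M w (act M w' u) @ act_section M w' u"
  by (induction w) (auto simp: act_append)

lemma state_word_Syn:
  assumes "u \<in> Syn M" "q \<in> states M"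
  shows "state_word M q u = sync_state M u"
  using assms by (force simp: Syn_def state_set_word_def card_1_singleton_iff)

lemma act_eq_sym: "act_eq M w w' \<Longrightarrow> act_eq M w' w"
  by (simp add: act_eq_def)

lemma act_eq_trans: "act_eq M w w' \<Longrightarrow> act_eq M w' w'' \<Longrightarrow> act_eq M w w''"
  by (simp add: act_eq_def)

text \<open>Products preserve length, so equal outputs on \<open>u @ v\<close> split into equal
  outputs on \<open>u\<close> and equal remainders, which are the outputs of the sections on
  \<open>v\<close>.\<close>

lemma act_eq_section:
  assumes "act_eq M w w'" "u \<in> lists (alphabet M)"
  shows "act_eq M (act_section M w u) (act_section M w' u)"
  unfolding act_eq_def
proof
  fix v assume "v \<in> lists (alphabet M)"
  with assms have "act M w (u @ v) = act M w' (u @ v)"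
    by (auto simp: act_eq_def)
  then show "act M (act_section M w u) v = act M (act_section M w' u) v"
    by (simp add: act_word_append)
qed

section \<open>Closure, cancellation and reset words\<close>

context mealy_automaton
begin

lemma state_word_closed:
  "q \<in> states M \<Longrightarrow> u \<in> lists (alphabet M) \<Longrightarrow> state_word M q u \<in> states M"
  by (induction u arbitrary: q) (auto simp: state_word_def next_state_closed)

lemma output_word_closed:
  "q \<in> states M \<Longrightarrow> u \<in> lists (alphabet M) \<Longrightarrow> output_word M q u \<in> lists (alphabet M)"
  by (induction u arbitrary: q) (auto simp: output_closed next_state_closed)

lemma act_closed:
  "w \<in> lists (states M) \<Longrightarrow> u \<in> lists (alphabet M) \<Longrightarrow> act M w u \<in> lists (alphabet M)"
  by (induction w) (auto simp: output_word_closed simp del: in_lists_conv_set)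

lemma act_section_closed:
  "w \<in> lists (states M) \<Longrightarrow> u \<in> lists (alphabet M) \<Longrightarrow> act_section M w u \<in> lists (states M)"
  by (induction w) (auto simp: act_closed state_word_closed simp del: in_lists_conv_set)

lemma output_word_surj:
  assumes "invertible_mealy M" "q \<in> states M" "v \<in> lists (alphabet M)"
  shows "\<exists>u\<in>lists (alphabet M). output_word M q u = v"
  using assms(2,3)
proof (induction v arbitrary: q)
  case Nil
  show ?case by (intro bexI[of _ "[]"]) auto
next
  case (Cons b v)
  have "b \<in> out_letter M q ` alphabet M" and v: "v \<in> lists (alphabet M)"
    using assms(1) Cons.prems by (simp_all add: invertible_mealy_def bij_betw_def)
  then obtain a where a: "a \<in> alphabet M" "out_letter M q a = b"
    by blast
  obtain u where "u \<in> lists (alphabet M)" "output_word M (next_state M q a) u = v"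
    using Cons.IH[OF next_state_closed[OF Cons.prems(1) a(1)] v] by blast
  with a have "a # u \<in> lists (alphabet M)" "output_word M q (a # u) = b # v"
    by simp_all
  then show ?case by blast
qed

text \<open>The last factor acts first and, by invertibility, is onto; so every argument of
  \<open>w\<close> and \<open>w'\<close> arises as its output.\<close>

lemma act_eq_snoc_cancel:
  assumes "invertible_mealy M" "q \<in> states M" "act_eq M (w @ [q]) (w' @ [q])"
  shows "act_eq M w w'"
  unfolding act_eq_def
proof
  fix v assume "v \<in> lists (alphabet M)"
  then obtain u where "u \<in> lists (alphabet M)" "output_word M q u = v"
    using output_word_surj assms by blast
  with assms(3) show "act M w v = act M w' v"
    by (auto simp: act_eq_def act_append)
qed

lemma act_section_snoc_Syn:
  assumes "u \<in> Syn M" "q \<in> states M"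
  shows "act_section M (w @ [q]) u = act_section M w (output_word M q u) @ [sync_state M u]"
  using assms by (simp add: act_section_append state_word_Syn)

lemma sync_state_in_states:
  assumes "u \<in> Syn M"
  shows "sync_state M u \<in> states M"
proof -
  obtain q where q: "q \<in> states M"
    using assms by (fastforce simp: Syn_def state_set_word_def)
  have "u \<in> lists (alphabet M)"
    using assms by (simp add: Syn_def)
  then show ?thesis
    using state_word_closed[OF q] state_word_Syn[OF assms q] by metis
qed

end

section \<open>Faithfulness of the action of state words\<close>

locale separated_reset_mealy = mealy_automaton M for M :: "('q, 'a) mealy" +
  assumes inv: "invertible_mealy M"
    and reset: "reset_mealy M"
    and separated: "inj_on (modified_state_fun M) (states M)"
begin

lemma output_word_Syn:
  assumes "q \<in> states M" "u \<in> Syn M"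
  shows "output_word M q u \<in> Syn M"
proof -
  have "mealy_fun M q u \<in> Syn M"
    using reset assms by (auto simp: reset_mealy_def)
  then show ?thesis
    using assms by (simp add: mealy_fun_def Syn_def)
qed

lemma separating_reset_word:
  assumes "p \<in> states M" "q \<in> states M" "p \<noteq> q"
  obtains u where "u \<in> Syn M"
    "sync_state M (output_word M p u) \<noteq> sync_state M (output_word M q u)"
proof -
  have "modified_state_fun M p \<noteq> modified_state_fun M q"
    using separated assms by (auto dest: inj_onD)
  then obtain u where "u \<in> Syn M" "modified_state_fun M p u \<noteq> modified_state_fun M q u"
    unfolding modified_state_fun_def by (metis (no_types, lifting) restrict_ext restrict_apply')
  then show ?thesis
    by (intro that[of u]) (auto simp: modified_state_fun_def mealy_fun_def Syn_def)
qed

text \<open>A reset word brings \<open>p\<close> and \<open>q\<close> to the same state, so the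
  sections end in a common factor, which cancels even if \<open>p\<close> and \<open>q\<close>
  differ.\<close>

lemma act_eq_section_Syn_cancel:
  assumes "u \<in> Syn M" "p \<in> states M" "q \<in> states M" "act_eq M (w @ [p]) (w' @ [q])"
  shows "act_eq M (act_section M w (output_word M p u)) (act_section M w' (output_word M q u))"
proof -
  have "u \<in> lists (alphabet M)"
    using assms(1) by (simp add: Syn_def)
  from act_eq_section[OF assms(4) this] show ?thesis
    using assms(1-3) act_eq_snoc_cancel[OF inv sync_state_in_states]
    by (simp add: act_section_snoc_Syn)
qed

lemma act_eq_same_length:
  assumes "w \<in> lists (states M)" "w' \<in> lists (states M)" "length w = length w'" "act_eq M w w'"
  shows "w = w'"
  using assms
proof (induction "length w" arbitrary: w w')
  case 0
  then show ?case by simp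
next
  case (Suc n)
  obtain x p where w: "w = x @ [p]"
    using Suc.hyps(2) by (cases w rule: rev_cases) auto
  obtain y q where w': "w' = y @ [q]"
    using Suc.hyps(2) Suc.prems(3) by (cases w' rule: rev_cases) auto
  have mem: "x \<in> lists (states M)" "y \<in> lists (states M)" "p \<in> states M" "q \<in> states M"
    using Suc.prems w w' by auto
  have len: "n = length x" "length x = length y"
    using Suc w w' by auto
  show ?case
  proof (cases "p = q")
    case True
    then have "act_eq M x y"
      using act_eq_snoc_cancel inv mem Suc.prems w w' by blast
    then show ?thesis
      using Suc.hyps(1) len mem w w' True by blast
  next
    case False
    obtain u where u: "u \<in> Syn M"
      "sync_state M (output_word M p u) \<noteq> sync_state M (output_word M q u)"
      using separating_reset_word mem False by blast
    have out: "output_word M p u \<in> Syn M" "output_word M q u \<in> Syn M"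
      using output_word_Syn mem u by auto
    have "act_eq M (act_section M x (output_word M p u)) (act_section M y (output_word M q u))"
      using act_eq_section_Syn_cancel u(1) mem Suc.prems(4) w w' by blast
    \<comment> \<open>The induction hypothesis applies to the cancelled sections, which are one
      factor shorter; the rest of this case derives a contradiction.\<close>
    then have eq: "act_section M x (output_word M p u) = act_section M y (output_word M q u)"
      using Suc.hyps(1) len mem out act_section_closed by (simp add: Syn_def)
    show ?thesis
    proof (cases x rule: rev_cases)
      \<comment> \<open>For single states the sections are empty and carry no information, but the
        outputs on \<open>u\<close> must agree, against the choice of \<open>u\<close>.\<close>
      case Nil
      then have "act M [p] u = act M [q] u"
        using Suc.prems(4) len w w' u(1) by (auto simp: act_eq_def Syn_def)
      then show ?thesis using u by simp
    next
      case (snoc x' p')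
      then obtain y' q' where "y = y' @ [q']"
        using len by (cases y rule: rev_cases) auto
      \<comment> \<open>The outputs of \<open>p\<close> and \<open>q\<close> on \<open>u\<close> are
        again reset words, so the last entries of the two equal sections are their synchronized
        states, which differ.\<close>
      with snoc eq u show ?thesis
        using mem out by (simp add: act_section_append state_word_Syn)
    qed
  qed
qed

lemma sync_state_nonconstant:
  assumes "card (states M) \<ge> 2"
  obtains u v where "u \<in> Syn M" "v \<in> Syn M" "sync_state M u \<noteq> sync_state M v"
proof -
  obtain p q where "p \<in> states M" "q \<in> states M" "p \<noteq> q"
    using assms by (metis (no_types, opaque_lifting) card_2_iff' obtain_subset_with_card_n subsetD)
  \<comment> \<open>The two words are the outputs of \<open>p\<close> and \<open>q\<close> on a
    reset word separating them.\<close>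
  then show ?thesis
    using that separating_reset_word output_word_Syn by metis
qed

lemma not_act_eq_Nil:
  assumes "card (states M) \<ge> 2" "w \<in> lists (states M)" "w \<noteq> []"
  shows "\<not> act_eq M w []"
proof
  assume eq: "act_eq M w []"
  obtain u v where uv: "u \<in> Syn M" "v \<in> Syn M" "sync_state M u \<noteq> sync_state M v"
    using sync_state_nonconstant assms(1) by blast
  obtain x p where w: "w = x @ [p]" and p: "p \<in> states M"
    using assms by (cases w rule: rev_cases) auto
  have A: "u \<in> lists (alphabet M)" "v \<in> lists (alphabet M)"
    using uv by (auto simp: Syn_def)
  have "act_eq M (act_section M w u) []" "act_eq M (act_section M w v) []"
    using act_eq_section[OF eq] A by auto
  then have "act_eq M (act_section M w u) (act_section M w v)"
    using act_eq_sym act_eq_trans by blast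
  then have "act_section M w u = act_section M w v"
    using act_eq_same_length act_section_closed assms(2) A by simp
  \<comment> \<open>The last entries of these sections are the distinct
    \<open>sync_state M u\<close> and \<open>sync_state M v\<close>.\<close>
  then show False
    using uv p w by (simp add: act_section_snoc_Syn)
qed

text \<open>Both words lose one factor at a time; if \<open>w\<close> were exhausted first, a
  nonempty remainder of \<open>w'\<close> would act as the identity. Symmetry of
  \<open>act_eq\<close> then yields equal lengths.\<close>

lemma act_eq_length_le:
  assumes "card (states M) \<ge> 2"
    and "w \<in> lists (states M)" "w' \<in> lists (states M)" "act_eq M w w'"
  shows "length w' \<le> length w"
  using assms(2-)
proof (induction "length w" arbitrary: w w')
  case 0
  then show ?case
    using not_act_eq_Nil[OF assms(1)] act_eq_sym by auto
next
  case (Suc n)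
  obtain x p where w: "w = x @ [p]"
    using Suc.hyps(2) by (cases w rule: rev_cases) auto
  show ?case
  proof (cases w' rule: rev_cases)
    case Nil
    then show ?thesis by simp
  next
    case (snoc y q)
    have mem: "x \<in> lists (states M)" "y \<in> lists (states M)" "p \<in> states M" "q \<in> states M"
      using Suc.prems w snoc by auto
    \<comment> \<open>Only lengths matter here, so any reset word will do.\<close>
    obtain u where u: "u \<in> Syn M"
      using reset by (auto simp: reset_mealy_def synchronizing_def)
    have "output_word M p u \<in> lists (alphabet M)" "output_word M q u \<in> lists (alphabet M)"
      using output_word_closed mem u by (auto simp: Syn_def)
    then have "act_section M x (output_word M p u) \<in> lists (states M)"
      "act_section M y (output_word M q u) \<in> lists (states M)"
      using act_section_closed mem by blast+
    moreover have
      "act_eq M (act_section M x (output_word M p u)) (act_section M y (output_word M q u))"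
      using act_eq_section_Syn_cancel u mem Suc.prems(3) w snoc by blast
    moreover have "n = length (act_section M x (output_word M p u))"
      using Suc.hyps(2) w by simp
    ultimately have "length (act_section M y (output_word M q u))
        \<le> length (act_section M x (output_word M p u))"
      using Suc.hyps(1) by blast
    then show ?thesis using w snoc by simp
  qed
qed

lemma act_eq_imp_eq:
  assumes "card (states M) \<ge> 2"
    and "w \<in> lists (states M)" "w' \<in> lists (states M)" "act_eq M w w'"
  shows "w = w'"
  using assms act_eq_same_length act_eq_length_le act_eq_sym by (meson le_antisym)

end

section \<open>From state words to the automata semigroup\<close>

context mealy_automaton
begin

text \<open>Since \<open>w'\<close> maps words over the alphabet to such words, the restriction
  inside \<open>act_fun M w\<close> has no effect.\<close>

lemma compose_act_fun:
  assumes "w' \<in> lists (states M)"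
  shows "compose (lists (alphabet M)) (act_fun M w) (act_fun M w') = act_fun M (w @ w')"
  using act_closed[OF assms] by (auto simp: act_fun_def compose_def act_append)

lemma word_prod_mealy_fun:
  assumes "w \<in> lists (states M)" "w \<noteq> []"
  shows "word_prod (compose (lists (alphabet M))) (map (mealy_fun M) w) = act_fun M w"
  using assms
proof (induction w rule: induct_list012)
  case (3 p q w)
  then show ?case
    using compose_act_fun[of "q # w" "[p]"] by (simp add: mealy_fun_eq_act_fun)
qed (simp_all add: mealy_fun_eq_act_fun)

lemma automata_semigroup_eq:
  "automata_semigroup M = act_fun M ` {w \<in> lists (states M). w \<noteq> []}"
    (is "_ = _ ` ?W")
proof
  show "automata_semigroup M \<subseteq> act_fun M ` ?W"
  proof
    fix f assume "f \<in> automata_semigroup M"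
    then show "f \<in> act_fun M ` ?W"
      unfolding automata_semigroup_def
    proof induction
      case (generator f)
      then obtain q where "q \<in> states M" "f = act_fun M [q]"
        by (auto simp: mealy_fun_eq_act_fun)
      then show ?case by (intro image_eqI[of _ _ "[q]"]) auto
    next
      case (mult f g)
      then obtain w w' where "w \<in> ?W" "w' \<in> ?W" "f = act_fun M w" "g = act_fun M w'"
        by blast
      then show ?case
        using compose_act_fun[of w' w] by (intro image_eqI[of _ _ "w @ w'"]) auto
    qed
  qed
  have "act_fun M w \<in> automata_semigroup M" if "w \<in> lists (states M)" "w \<noteq> []" for w
    using that(2,1)
  proof (induction w rule: list_nonempty_induct)
    case (single q)
    then show ?case
      by (auto simp: automata_semigroup_def mealy_fun_eq_act_fun
          intro: generated_semigroup.generator)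
  next
    case (cons q w)
    then have "act_fun M (q # w) = compose (lists (alphabet M)) (mealy_fun M q) (act_fun M w)"
      using compose_act_fun[of w "[q]"] by (simp add: mealy_fun_eq_act_fun)
    with cons show ?case
      by (simp add: automata_semigroup_def generated_semigroup.mult generated_semigroup.generator)
  qed
  then show "act_fun M ` ?W \<subseteq> automata_semigroup M" by blast
qed

lemma is_semigroup_automata_semigroup:
  "is_semigroup (automata_semigroup M) (compose (lists (alphabet M)))"
  unfolding is_semigroup_def
proof (intro conjI ballI)
  fix f g assume "f \<in> automata_semigroup M" "g \<in> automata_semigroup M"
  then show "compose (lists (alphabet M)) f g \<in> automata_semigroup M"
    unfolding automata_semigroup_def by (rule generated_semigroup.mult)
next
  fix f g h
  assume "f \<in> automata_semigroup M" "g \<in> automata_semigroup M" "h \<in> automata_semigroup M"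
  then obtain u v w where "v \<in> lists (states M)" "w \<in> lists (states M)"
    "f = act_fun M u" "g = act_fun M v" "h = act_fun M w"
    unfolding automata_semigroup_eq by blast
  then show "compose (lists (alphabet M)) (compose (lists (alphabet M)) f g) h
      = compose (lists (alphabet M)) f (compose (lists (alphabet M)) g h)"
    by (simp add: compose_act_fun)
qed

end

theorem theorem1:
  fixes M :: "('q, 'a) mealy"
  assumes "mealy_automaton M"
    and "invertible_mealy M"
    and "reset_mealy M"
    and "card (states M) \<ge> 2"
    and "inj_on (modified_state_fun M) (states M)"
  shows "free_semigroup_on (automata_semigroup M) (compose (lists (alphabet M)))
           (mealy_fun M ` states M)"
proof -
  interpret separated_reset_mealy M
    using assms by (simp add: separated_reset_mealy_def separated_reset_mealy_axioms_def)
  let ?L = "lists (alphabet M)"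
  let ?W = "{w \<in> lists (states M). w \<noteq> []}"
  \<comment> \<open>Words over the generators are lifted to words over the states, where
    \<open>act_eq_imp_eq\<close> applies; any lift serves.\<close>
  have words: "{w \<in> lists (mealy_fun M ` states M). w \<noteq> []} = map (mealy_fun M) ` ?W"
    by (auto simp: lists_image)
  have prod: "word_prod (compose ?L) (map (mealy_fun M) w) = act_fun M w"
    if "w \<in> ?W" for w
    using that word_prod_mealy_fun by simp
  have "inj_on (word_prod (compose ?L)) (map (mealy_fun M) ` ?W)"
  proof (rule inj_onI, elim imageE)
    fix f g w w'
    assume "word_prod (compose ?L) f = word_prod (compose ?L) g"
      and fg: "f = map (mealy_fun M) w" "g = map (mealy_fun M) w'" and W: "w \<in> ?W" "w' \<in> ?W"
    then have "act_eq M w w'"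
      using prod by (simp add: act_fun_eq_iff)
    then show "f = g"
      using act_eq_imp_eq assms(4) W fg by blast
  qed
  moreover have "word_prod (compose ?L) ` map (mealy_fun M) ` ?W = automata_semigroup M"
    unfolding automata_semigroup_eq image_image by (rule image_cong[OF refl prod])
  moreover have "mealy_fun M ` states M \<subseteq> automata_semigroup M"
    by (auto simp: automata_semigroup_def intro: generated_semigroup.generator)
  ultimately show ?thesis
    using is_semigroup_automata_semigroup
    by (simp only: free_semigroup_on_def bij_betw_def words simp_thms)
qed

end
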